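(* For every $N\ge 1$, the family of lollipop graphs $\{L_{m,n}\}$ on $m+n=N$ vertices (with $m\geq 1$, $n\ge 0$) forms a chain in the poset $\mathcal{E}_N$. In particular, for $m\geq 3$ and $n\geq 0$, $$L_{m-1,n+1}\geq_e L_{m,n}.$$ Hence, the path $P_N$ is the maximal element and the complete graph $K_N$ is the minimal element of the chain.
   Context: All graphs are finite and simple. For $m\ge1$, $n\ge0$ and $N=m+n$, the lollipop graph $L_{m,n}$ is the graph on vertex set $\{1,\dots,N\}$ with all edges between distinct vertices in $\{1,\dots,m\}$ and the edges joining $i$ and $i+1$ for $m\le i\le N-1$. Thus $L_{N,0}=K_N$ is the complete graph and $L_{1,N-1}=P_N$ is the path on $N$ vertices. The chromatic symmetric function of a graph $G$ with vertices $v_1,\dots,v_N$ is $X_G=\sum_{\kappa}x_{\kappa(v_1)}\cdots x_{\kappa(v_N)}$, summed over all proper colorings $\kappa:V(G)\to\{1,2,3,\dots\}$; it is a homogeneous symmetric function of degree $N$ over $\mathbb{Q}$. Let $e_\lambda=e_{\lambda_1}e_{\lambda_2}\cdots$ be the elementary symmetric functions; $[e_\lambda]F$ denotes the coefficient of $e_\lambda$ in $F$ expanded in this basis, and $F$ is $e$-positive if $[e_\lambda]F\ge 0$ for all $\lambda$. For connected graphs $G,H$ on $N$ vertices (for which $[e_{(N)}]X_G$ and $[e_{(N)}]X_H$ are positive), set $$X_e(G,H)=X_G-\frac{[e_{(N)}]X_G}{[e_{(N)}]X_H}X_H.$$ $\mathcal{E}_N$ is the poset whose elements are the equivalence classes of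 connected graphs on $N$ vertices under $G\sim H\iff X_G=X_H$, ordered by $G\geq_e H$ if and only if $X_e(G,H)$ is $e$-positive. A chain is a set of pairwise comparable elements. *)

theory Defs
  imports Complex_Main "HOL-Library.Multiset" "HOL-Library.FuncSet"
begin

section \<open>Formal power series in infinitely many variables\<close>

text \<open>
  A monomial in the variables \<open>x\<^sub>1, x\<^sub>2, \<dots>\<close> is the multiset of the indices of its variables,
  so that multiplication of monomials is addition of multisets. A series is the family of its
  coefficients. The index type is \<^typ>\<open>nat\<close>; the index 0 is never used below.
\<close>

typedef mseries = "UNIV :: (nat multiset \<Rightarrow> rat) set"
  morphisms mcoeff MSeries
  by simp

setup_lifting type_definition_mseries

lemma mseries_eqI: "(\<And>m. mcoeff F m = mcoeff G m) \<Longrightarrow> F = G"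
  by (metis mcoeff_inject ext)

lemma finite_splits: "finite {(a, b). a + b = (m :: 'a multiset)}"
proof (induction m)
  case empty
  have "{(a, b). a + b = ({#} :: 'a multiset)} = {({#}, {#})}" by auto
  then show ?case by simp
next
  case (add x m)
  let ?S = "{(a, b). a + b = m}"
  have "{(a, b). a + b = add_mset x m}
    \<subseteq> (\<lambda>(a, b). (add_mset x a, b)) ` ?S \<union> (\<lambda>(a, b). (a, add_mset x b)) ` ?S"
  proof (rule subsetI, clarify)
    fix a b :: "'a multiset"
    assume eq: "a + b = add_mset x m" and
      no: "(a, b) \<notin> (\<lambda>(a, b). (a, add_mset x b)) ` ?S"
    from eq have "x \<in># a + b" by simp
    then consider "x \<in># a" | "x \<in># b" by auto
    then show "(a, b) \<in> (\<lambda>(a, b). (add_mset x a, b)) ` ?S"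
    proof cases
      case 1
      then obtain a' where "a = add_mset x a'" by (meson mset_add)
      then show ?thesis using eq by (intro image_eqI[of _ _ "(a', b)"]) auto
    next
      case 2
      then obtain b' where "b = add_mset x b'" by (meson mset_add)
      then have "(a, b) \<in> (\<lambda>(a, b). (a, add_mset x b)) ` ?S"
        using eq by (intro image_eqI[of _ _ "(a, b')"]) auto
      then show ?thesis using no by blast
    qed
  qed
  then show ?case using add.IH by (meson finite_UnI finite_imageI finite_subset)
qed

instantiation mseries :: comm_ring_1
begin

lift_definition zero_mseries :: mseries is "\<lambda>_. 0" .
lift_definition one_mseries :: mseries is "\<lambda>m. if m = {#} then 1 else 0" .
lift_definition plus_mseries :: "mseries \<Rightarrow> mseries \<Rightarrow> mseries" is "\<lambda>F G m. F m + G m" .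
lift_definition minus_mseries :: "mseries \<Rightarrow> mseries \<Rightarrow> mseries" is "\<lambda>F G m. F m - G m" .
lift_definition uminus_mseries :: "mseries \<Rightarrow> mseries" is "\<lambda>F m. - F m" .
lift_definition times_mseries :: "mseries \<Rightarrow> mseries \<Rightarrow> mseries"
  is "\<lambda>F G m. \<Sum>(a, b) | a + b = m. F a * G b" .

instance
proof
  fix F G H :: mseries
  show "F + G + H = F + (G + H)" by transfer (simp add: algebra_simps)
  show "F + G = G + F" by transfer (simp add: algebra_simps)
  show "0 + F = F" by transfer simp
  show "- F + F = 0" by transfer simp
  show "F - G = F + - G" by transfer simp
  show "(0 :: mseries) \<noteq> 1" by transfer (metis zero_neq_one)
  show "(F + G) * H = F * H + G * H"
    by transfer (simp add: algebra_simps sum.distrib case_prod_unfold)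
  show "F * G = G * F"
    by transfer (intro ext sum.reindex_bij_witness[where i = prod.swap and j = prod.swap],
        auto simp: ac_simps)
  show "1 * F = F"
  proof (rule mseries_eqI)
    fix m
    have "mcoeff (1 * F) m
      = (\<Sum>(a, b) | a + b = m. (if a = {#} then 1 else 0) * mcoeff F b)"
      by (simp add: times_mseries.rep_eq one_mseries.rep_eq)
    also have "\<dots> = (\<Sum>(a, b) \<in> {({#} :: nat multiset, m)}. (if a = {#} then 1 else 0) * mcoeff F b)"
      by (intro sum.mono_neutral_right finite_splits) (auto split: if_splits)
    finally show "mcoeff (1 * F) m = mcoeff F m" by simp
  qed
  show "F * G * H = F * (G * H)"
  proof (rule mseries_eqI)
    fix m
    let ?f = "mcoeff F" and ?g = "mcoeff G" and ?h = "mcoeff H"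
    have fin: "finite {(a, b). a + b = (d :: nat multiset)}" for d by (rule finite_splits)
    have "mcoeff (F * G * H) m
      = (\<Sum>p \<in> {(d, c). d + c = m}. \<Sum>q \<in> {(a, b). a + b = fst p}. ?f (fst q) * ?g (snd q) * ?h (snd p))"
      by (simp add: times_mseries.rep_eq case_prod_unfold sum_distrib_right)
    also have "\<dots> = (\<Sum>(p, q) \<in> Sigma {(d, c). d + c = m} (\<lambda>p. {(a, b). a + b = fst p}).
        ?f (fst q) * ?g (snd q) * ?h (snd p))"
      by (rule sum.Sigma) (auto simp: fin)
    also have "\<dots> = (\<Sum>(p, q) \<in> Sigma {(a, d). a + d = m} (\<lambda>p. {(b, c). b + c = snd p}).
        ?f (fst p) * (?g (fst q) * ?h (snd q)))"
      by (rule sum.reindex_bij_witness[where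
            i = "\<lambda>((a, d), (b, c)). ((a + b, c), (a, b))" and
            j = "\<lambda>((d, c), (a, b)). ((a, b + c), (b, c))"]) (auto simp: ac_simps)
    also have "\<dots> = (\<Sum>p \<in> {(a, d). a + d = m}. \<Sum>q \<in> {(b, c). b + c = snd p}.
        ?f (fst p) * (?g (fst q) * ?h (snd q)))"
      by (rule sum.Sigma[symmetric]) (auto simp: fin)
    also have "\<dots> = mcoeff (F * (G * H)) m"
      by (simp add: times_mseries.rep_eq case_prod_unfold sum_distrib_left)
    finally show "mcoeff (F * G * H) m = mcoeff (F * (G * H)) m" .
  qed
qed

end

lift_definition smult :: "rat \<Rightarrow> mseries \<Rightarrow> mseries" is "\<lambda>c F m. c * F m" .


section \<open>Elementary symmetric functions\<close>

lift_definition elem_sym :: "nat \<Rightarrow> mseries"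
  is "\<lambda>k m. if m \<in> mset_set ` {S. finite S \<and> S \<subseteq> {1..} \<and> card S = k} then 1 else 0" .

definition partition :: "nat multiset \<Rightarrow> bool" where
  "partition p \<longleftrightarrow> 0 \<notin># p"

definition elem_sym_prod :: "nat multiset \<Rightarrow> mseries" where
  "elem_sym_prod p = (\<Prod>k\<in>#p. elem_sym k)"

definition e_expansion :: "mseries \<Rightarrow> (nat multiset \<Rightarrow> rat) \<Rightarrow> bool" where
  "e_expansion F c \<longleftrightarrow>
     finite {p. c p \<noteq> 0} \<and> (\<forall>p. c p \<noteq> 0 \<longrightarrow> partition p) \<and>
     F = (\<Sum>p | c p \<noteq> 0. smult (c p) (elem_sym_prod p))"

text \<open>The description is proper since the \<open>e\<^sub>\<lambda>\<close> form a basis of the symmetric functions; the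
  value is unspecified if \<open>F\<close> is not symmetric of bounded degree.\<close>

definition e_coeff :: "nat multiset \<Rightarrow> mseries \<Rightarrow> rat" where
  "e_coeff p F = (THE c. e_expansion F c) p"

definition e_positive :: "mseries \<Rightarrow> bool" where
  "e_positive F \<longleftrightarrow> (\<forall>p. partition p \<longrightarrow> e_coeff p F \<ge> 0)"


section \<open>Graphs and chromatic symmetric functions\<close>

type_synonym graph = "nat set \<times> nat set set"

abbreviation verts :: "graph \<Rightarrow> nat set" where "verts \<equiv> fst"
abbreviation edges :: "graph \<Rightarrow> nat set set" where "edges \<equiv> snd"

definition simple_graph :: "graph \<Rightarrow> bool" where
  "simple_graph G \<longleftrightarrow> finite (verts G) \<and> edges G \<subseteq> {{u, v} | u v. u \<in> verts G \<and> v \<in> verts G \<and> u \<noteq> v}"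

definition connected_graph :: "graph \<Rightarrow> bool" where
  "connected_graph G \<longleftrightarrow> simple_graph G \<and> verts G \<noteq> {} \<and>
     (\<forall>u\<in>verts G. \<forall>v\<in>verts G. (u, v) \<in> {(a, b). {a, b} \<in> edges G}\<^sup>*)"

definition lollipop :: "nat \<Rightarrow> nat \<Rightarrow> graph" where
  "lollipop m n = ({1..m + n},
     {{i, j} | i j. i \<in> {1..m} \<and> j \<in> {1..m} \<and> i \<noteq> j} \<union> {{i, i + 1} | i. m \<le> i \<and> i < m + n})"

definition path_graph :: "nat \<Rightarrow> graph" where
  "path_graph N = ({1..N}, {{i, i + 1} | i. 1 \<le> i \<and> i < N})"

definition complete_graph :: "nat \<Rightarrow> graph" where
  "complete_graph N = ({1..N}, {{i, j} | i j. i \<in> {1..N} \<and> j \<in> {1..N} \<and> i \<noteq> j})"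

definition proper_colorings :: "graph \<Rightarrow> (nat \<Rightarrow> nat) set" where
  "proper_colorings G =
     {\<kappa> \<in> verts G \<rightarrow>\<^sub>E {1..}. \<forall>u v. {u, v} \<in> edges G \<longrightarrow> \<kappa> u \<noteq> \<kappa> v}"

text \<open>The coefficient of a monomial in the sum \<open>\<Sum>\<^sub>\<kappa> \<Prod>\<^sub>v x\<^bsub>\<kappa>(v)\<^esub>\<close> is the number of proper
  colorings \<open>\<kappa>\<close> whose term is this monomial.\<close>

lift_definition chrom_sym :: "graph \<Rightarrow> mseries"
  is "\<lambda>G m. of_nat (card {\<kappa> \<in> proper_colorings G. image_mset \<kappa> (mset_set (verts G)) = m})" .

definition X_e :: "graph \<Rightarrow> graph \<Rightarrow> mseries" where
  "X_e G H = chrom_sym G -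
     smult (e_coeff {#card (verts G)#} (chrom_sym G) / e_coeff {#card (verts H)#} (chrom_sym H))
       (chrom_sym H)"


section \<open>The poset of connected graphs on \<open>N\<close> vertices\<close>

text \<open>Every finite graph is isomorphic to one with vertices in \<^typ>\<open>nat\<close>, and isomorphic graphs
  have the same chromatic symmetric function.\<close>

definition connected_graphs :: "nat \<Rightarrow> graph set" where
  "connected_graphs N = {G. connected_graph G \<and> card (verts G) = N}"

definition chrom_rel :: "nat \<Rightarrow> (graph \<times> graph) set" where
  "chrom_rel N = {(G, H) \<in> connected_graphs N \<times> connected_graphs N. chrom_sym G = chrom_sym H}"

definition E_set :: "nat \<Rightarrow> graph set set" where
  "E_set N = connected_graphs N // chrom_rel N"

text \<open>The pair \<open>(A, B)\<close> belongs to \<open>E_le N\<close> iff \<open>B \<ge>\<^sub>e A\<close>. Since \<^term>\<open>X_e G H\<close> depends on \<open>G\<close> and \<open>H\<close>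
  only through their chromatic symmetric functions and \<open>N\<close>, the choice of representatives is
  immaterial.\<close>

definition E_le :: "nat \<Rightarrow> (graph set \<times> graph set) set" where
  "E_le N = {(A, B) \<in> E_set N \<times> E_set N. \<exists>G\<in>B. \<exists>H\<in>A. e_positive (X_e G H)}"

definition E_class :: "nat \<Rightarrow> graph \<Rightarrow> graph set" where
  "E_class N G = chrom_rel N `` {G}"

definition lollipop_classes :: "nat \<Rightarrow> graph set set" where
  "lollipop_classes N = {E_class N (lollipop m n) | m n. m \<ge> 1 \<and> m + n = N}"

definition maximal_in :: "('a \<times> 'a) set \<Rightarrow> 'a set \<Rightarrow> 'a \<Rightarrow> bool" where
  "maximal_in r C x \<longleftrightarrow> x \<in> C \<and> (\<forall>y\<in>C. (x, y) \<in> r \<longrightarrow> y = x)"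

definition minimal_in :: "('a \<times> 'a) set \<Rightarrow> 'a set \<Rightarrow> 'a \<Rightarrow> bool" where
  "minimal_in r C x \<longleftrightarrow> x \<in> C \<and> (\<forall>y\<in>C. (y, x) \<in> r \<longrightarrow> y = x)"

end

theory Submission
  imports Defs "HOL-Combinatorics.Multiset_Permutations"
begin

text \<open>
  Comparing, for a complete graph and a disjoint path, the colorings that violate the edges between
  them gives \<open>X(L\<^bsub>k+1,n\<^esub>) = k X(L\<^bsub>k,n+1\<^esub>) - (k-1) k! e\<^sub>k X(P\<^bsub>n+1\<^esub>)\<close>. Telescoping from \<open>P\<^sub>N\<close> to
  \<open>K\<^sub>N\<close> yields \<open>X(L\<^bsub>k,N-k\<^esub>) = (k-1)! (N e\<^sub>N + \<Sum> (j-1) e\<^sub>j X(P\<^bsub>N-j\<^esub>))\<close> with the sum over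
  \<open>k \<le> j < N\<close>. The case \<open>k = 1\<close> shows by induction that paths are e-positive. Since the coefficient of
  \<open>e\<^sub>N\<close> is \<open>(k-1)! N\<close>, the series \<open>X\<^sub>e\<close> of two lollipops is a multiple of a partial sum of e-positive
  terms. If it is e-positive in both directions, then the two chromatic symmetric functions are
  proportional, hence equal because both have coefficient \<open>N!\<close> at \<open>x\<^sub>1 \<cdots> x\<^sub>N\<close>. The
  products \<open>e\<^sub>\<lambda>\<close> are linearly independent because the monomials of \<open>e\<^sub>\<lambda>\<close> are dominated by the one
  with exponents the conjugate partition of \<open>\<lambda>\<close>.
\<close>

section \<open>Scalar multiplication of series\<close>

lemma mcoeff_simps [simp]:
  "mcoeff 0 x = 0"
  "mcoeff (F + G) x = mcoeff F x + mcoeff G x"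
  "mcoeff (F - G) x = mcoeff F x - mcoeff G x"
  "mcoeff (- F) x = - mcoeff F x"
  "mcoeff (smult c F) x = c * mcoeff F x"
  by (transfer, simp)+

lemma mcoeff_sum [simp]: "mcoeff (sum f A) x = (\<Sum>i\<in>A. mcoeff (f i) x)"
  by (induction A rule: infinite_finite_induct) auto

lemma smult_smult [simp]: "smult a (smult b F) = smult (a * b) F"
  by (rule mseries_eqI) simp

lemma smult_1 [simp]: "smult 1 F = F"
  by (rule mseries_eqI) simp

lemma smult_0 [simp]: "smult 0 F = 0"
  by (rule mseries_eqI) simp

lemma smult_add_right: "smult a (F + G) = smult a F + smult a G"
  by (rule mseries_eqI) (simp add: algebra_simps)

lemma smult_diff_right: "smult a (F - G) = smult a F - smult a G"
  by (rule mseries_eqI) (simp add: algebra_simps)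

lemma smult_add_left: "smult (a + b) F = smult a F + smult b F"
  by (rule mseries_eqI) (simp add: algebra_simps)

lemma smult_sum_right: "smult a (sum f A) = (\<Sum>i\<in>A. smult a (f i))"
  by (rule mseries_eqI) (simp add: sum_distrib_left)

lemma smult_mult_left: "smult a F * G = smult a (F * G)"
  by (rule mseries_eqI) (simp add: times_mseries.rep_eq sum_distrib_left case_prod_unfold mult.assoc)

lemma smult_mult_right: "F * smult a G = smult a (F * G)"
  by (metis mult.commute smult_mult_left)

lemma smult_cancel: "c \<noteq> 0 \<Longrightarrow> smult c F = smult c G \<longleftrightarrow> F = G"
  by (metis left_inverse smult_1 smult_smult)

section \<open>Linear independence of the products of elementary symmetric functions\<close>

text \<open>This is the sum of the first j parts of the conjugate partition of p, so the pointwise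
  order on these functions is the dominance order on conjugates.\<close>

definition truncated_size :: "nat multiset \<Rightarrow> nat \<Rightarrow> nat" where
  "truncated_size p j = (\<Sum>k\<in>#p. min k j)"

text \<open>The product of the initial monomials \<open>x_1 ... x_k\<close> of the factors
  \<open>e_k\<close>. Its exponents are the parts of the conjugate partition, already decreasing in
  the index, so \<open>low_size\<close> need not sort.\<close>

definition conj_monomial :: "nat multiset \<Rightarrow> nat multiset" where
  "conj_monomial p = (\<Sum>k\<in>#p. mset_set {1..k})"

definition low_size :: "nat multiset \<Rightarrow> nat \<Rightarrow> nat" where
  "low_size x j = size {#i \<in># x. i \<le> j#}"

lemma low_size_conj_monomial: "low_size (conj_monomial p) j = truncated_size p j"
proof (induction p)
  case empty
  then show ?case by (simp add: low_size_def conj_monomial_def truncated_size_def)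
next
  case (add k p)
  have "{i \<in> {1..k}. i \<le> j} = {1..min k j}" by auto
  then have "low_size (mset_set {1..k}) j = min k j"
    by (simp add: low_size_def filter_mset_mset_set)
  then show ?case using add
    by (simp add: low_size_def conj_monomial_def truncated_size_def)
qed

lemma elem_sym_prod_add_mset [simp]: "elem_sym_prod (add_mset k p) = elem_sym k * elem_sym_prod p"
  by (simp add: elem_sym_prod_def)

lemma elem_sym_prod_empty [simp]: "elem_sym_prod {#} = 1"
  by (simp add: elem_sym_prod_def)

lemma mcoeff_elem_sym_nonneg: "mcoeff (elem_sym k) x \<ge> 0"
  by (simp add: elem_sym.rep_eq)

lemma mcoeff_elem_sym_prod_nonneg: "mcoeff (elem_sym_prod p) x \<ge> 0"
proof (induction p arbitrary: x)
  case empty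
  then show ?case by (simp add: one_mseries.rep_eq)
next
  case (add k p)
  then show ?case
    by (auto simp: times_mseries.rep_eq intro!: sum_nonneg mult_nonneg_nonneg mcoeff_elem_sym_nonneg)
qed

text \<open>Each factor \<open>e_k\<close> contributes a set of k positive indices, and at most
  \<open>min k j\<close> of them can be \<le> j. The exclusion of index 0 matters for this
  bound.\<close>

lemma low_size_le_if_mcoeff_elem_sym_prod:
  "mcoeff (elem_sym_prod p) x \<noteq> 0 \<Longrightarrow> low_size x j \<le> truncated_size p j"
proof (induction p arbitrary: x)
  case empty
  then show ?case
    by (auto simp: one_mseries.rep_eq low_size_def split: if_splits)
next
  case (add k p)
  then have "(\<Sum>(a, b) | a + b = x. mcoeff (elem_sym k) a * mcoeff (elem_sym_prod p) b) \<noteq> 0"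
    by (simp add: times_mseries.rep_eq)
  then obtain a b where ab: "a + b = x" "mcoeff (elem_sym k) a \<noteq> 0" "mcoeff (elem_sym_prod p) b \<noteq> 0"
    by (auto elim!: sum.not_neutral_contains_not_neutral)
  from ab(2) obtain S where S: "a = mset_set S" "finite S" "S \<subseteq> {1..}" "card S = k"
    by (auto simp: elem_sym.rep_eq split: if_splits)
  have "card {i \<in> S. i \<le> j} \<le> card S" using S by (intro card_mono) auto
  moreover have "card {i \<in> S. i \<le> j} \<le> card {1..j}" using S by (intro card_mono) auto
  ultimately have "low_size a j \<le> min k j"
    using S by (simp add: low_size_def)
  moreover have "low_size b j \<le> truncated_size p j" using add.IH ab by blast
  ultimately show ?case using ab(1) by (auto simp: low_size_def truncated_size_def)
qed

text \<open>All coefficients are nonnegative, so nothing cancels and one splitting with a positive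
  contribution suffices.\<close>

lemma mcoeff_elem_sym_prod_conj_monomial: "mcoeff (elem_sym_prod p) (conj_monomial p) > 0"
proof (induction p)
  case empty
  then show ?case by (simp add: one_mseries.rep_eq conj_monomial_def)
next
  case (add k p)
  let ?f = "\<lambda>(a, b). mcoeff (elem_sym k) a * mcoeff (elem_sym_prod p) b"
  have "mset_set {1..k} \<in> mset_set ` {S. finite S \<and> S \<subseteq> {1..} \<and> card S = k}"
    by (intro imageI) auto
  then have "0 < ?f (mset_set {1..k}, conj_monomial p)"
    using add by (simp add: elem_sym.rep_eq)
  also have "\<dots> \<le> sum ?f {(a, b). a + b = conj_monomial (add_mset k p)}"
    by (intro member_le_sum)
      (auto simp: conj_monomial_def finite_splits
        intro!: mult_nonneg_nonneg mcoeff_elem_sym_nonneg mcoeff_elem_sym_prod_nonneg)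
  finally show ?case by (simp add: times_mseries.rep_eq)
qed

lemma truncated_size_Suc:
  "truncated_size p (Suc j) = truncated_size p j + size {#k \<in># p. j < k#}"
  by (induction p) (auto simp: truncated_size_def)

text \<open>First differences of \<open>truncated_size\<close> count the parts above j, and second
  differences give the multiplicity of each positive part. Parts 0 leave no trace in
  \<open>truncated_size\<close>; \<open>partition\<close> excludes them.\<close>

lemma partition_eqI:
  assumes "partition p" "partition q" "truncated_size p = truncated_size q"
  shows "p = q"
proof (rule multiset_eqI)
  fix k
  have large: "size {#i \<in># p. j < i#} = size {#i \<in># q. j < i#}" for j
    using truncated_size_Suc[of p j] truncated_size_Suc[of q j] assms(3) by simp
  have split: "size {#i \<in># r. j < i#} = count r (Suc j) + size {#i \<in># r. Suc j < i#}"
    for r :: "nat multiset" and j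
    by (induction r) auto
  show "count p k = count q k"
  proof (cases "k = 0")
    case True
    then show ?thesis using assms(1,2) by (simp add: partition_def not_in_iff)
  next
    case False
    then obtain j where "k = Suc j" by (cases k) auto
    then show ?thesis using split[of j p] split[of j q] large by simp
  qed
qed

text \<open>Triangularity: among the indices with nonzero coefficient take q with maximal
  \<open>truncated_size\<close>, and read off the coefficient of \<open>conj_monomial q\<close>.
  Only the summand of q can contribute to it.\<close>

lemma elem_sym_prod_independent:
  assumes "finite A" "\<forall>p\<in>A. partition p" "(\<Sum>p\<in>A. smult (c p) (elem_sym_prod p)) = 0" "p \<in> A"
  shows "c p = 0"
proof (rule ccontr)
  assume "c p \<noteq> 0"
  let ?S = "{p \<in> A. c p \<noteq> 0}"
  have "finite (truncated_size ` ?S)" "truncated_size ` ?S \<noteq> {}"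
    using assms(1,4) \<open>c p \<noteq> 0\<close> by auto
  from finite_has_maximal[OF this] obtain t
    where t: "t \<in> truncated_size ` ?S" "\<forall>s\<in>truncated_size ` ?S. t \<le> s \<longrightarrow> t = s"
    by blast
  then obtain q where q: "q \<in> ?S" "t = truncated_size q" by blast
  \<comment> \<open>If r contributed, \<open>conj_monomial q\<close> would be a monomial of
    \<open>e_r\<close>, so r would dominate q; maximality then forces r = q.\<close>
  have zero: "c r * mcoeff (elem_sym_prod r) (conj_monomial q) = 0" if "r \<in> A - {q}" for r
  proof (rule ccontr)
    assume r: "\<not> ?thesis"
    then have "truncated_size q \<le> truncated_size r"
      using low_size_le_if_mcoeff_elem_sym_prod[of r "conj_monomial q"]
      by (auto simp: le_fun_def low_size_conj_monomial)
    then have "truncated_size q = truncated_size r" using t q r that by auto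
    then show False using partition_eqI[of q r] assms(2) that q by auto
  qed
  have "0 = (\<Sum>r\<in>A. c r * mcoeff (elem_sym_prod r) (conj_monomial q))"
    using arg_cong[OF assms(3), of "\<lambda>F. mcoeff F (conj_monomial q)"] by simp
  also have "\<dots> = c q * mcoeff (elem_sym_prod q) (conj_monomial q)
      + (\<Sum>r\<in>A - {q}. c r * mcoeff (elem_sym_prod r) (conj_monomial q))"
    using q assms(1) by (intro sum.remove) auto
  also have "\<dots> = c q * mcoeff (elem_sym_prod q) (conj_monomial q)"
  proof -
    have "(\<Sum>r\<in>A - {q}. c r * mcoeff (elem_sym_prod r) (conj_monomial q)) = 0"
      using zero by (intro sum.neutral ballI)
    then show ?thesis by simp
  qed
  finally show False
    using q mcoeff_elem_sym_prod_conj_monomial[of q] by simp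
qed

section \<open>Calculus of expansions\<close>

lemma e_expansion_eq_sum:
  assumes "e_expansion F c" "finite A" "{p. c p \<noteq> 0} \<subseteq> A"
  shows "F = (\<Sum>p\<in>A. smult (c p) (elem_sym_prod p))"
proof -
  have "F = (\<Sum>p | c p \<noteq> 0. smult (c p) (elem_sym_prod p))"
    using assms(1) by (simp add: e_expansion_def)
  also have "\<dots> = (\<Sum>p\<in>A. smult (c p) (elem_sym_prod p))"
    using assms(2,3) by (intro sum.mono_neutral_left) auto
  finally show ?thesis .
qed

lemma e_expansionI:
  assumes "finite A" "\<And>p. c p \<noteq> 0 \<Longrightarrow> p \<in> A \<and> partition p"
    "F = (\<Sum>p\<in>A. smult (c p) (elem_sym_prod p))"
  shows "e_expansion F c"
  unfolding e_expansion_def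
proof (intro conjI)
  show "finite {p. c p \<noteq> 0}"
    using assms(1,2) by (auto intro: finite_subset)
  show "F = (\<Sum>p | c p \<noteq> 0. smult (c p) (elem_sym_prod p))"
    unfolding assms(3) using assms(1,2) by (intro sum.mono_neutral_right) auto
qed (use assms(2) in auto)

lemma e_expansion_add:
  assumes "e_expansion F c" "e_expansion G d"
  shows "e_expansion (F + G) (\<lambda>p. c p + d p)"
proof -
  let ?A = "{p. c p \<noteq> 0} \<union> {p. d p \<noteq> 0}"
  have "finite ?A" using assms by (simp add: e_expansion_def)
  then show ?thesis
  proof (rule e_expansionI)
    show "p \<in> ?A \<and> partition p" if "c p + d p \<noteq> 0" for p
    proof -
      have "c p \<noteq> 0 \<or> d p \<noteq> 0" using that by auto
      then show ?thesis using assms by (auto simp: e_expansion_def)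
    qed
    show "F + G = (\<Sum>p\<in>?A. smult (c p + d p) (elem_sym_prod p))"
      using e_expansion_eq_sum[OF assms(1) \<open>finite ?A\<close>] e_expansion_eq_sum[OF assms(2) \<open>finite ?A\<close>]
      by (simp add: smult_add_left sum.distrib)
  qed
qed

lemma e_expansion_smult:
  assumes "e_expansion F c"
  shows "e_expansion (smult a F) (\<lambda>p. a * c p)"
proof (rule e_expansionI)
  show "finite {p. c p \<noteq> 0}" using assms by (simp add: e_expansion_def)
  then show "smult a F = (\<Sum>p | c p \<noteq> 0. smult (a * c p) (elem_sym_prod p))"
    using e_expansion_eq_sum[OF assms] by (simp add: smult_sum_right)
qed (use assms in \<open>auto simp: e_expansion_def\<close>)

lemma e_expansion_diff:
  assumes "e_expansion F c" "e_expansion G d"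
  shows "e_expansion (F - G) (\<lambda>p. c p - d p)"
proof -
  have eq: "F - G = F + smult (-1) G" by (rule mseries_eqI) simp
  show ?thesis
    unfolding eq using e_expansion_add[OF assms(1) e_expansion_smult[OF assms(2), of "-1"]] by simp
qed

lemma e_expansion_zero: "e_expansion 0 (\<lambda>_. 0)"
  by (simp add: e_expansion_def)

lemma e_expansion_one: "e_expansion 1 (\<lambda>p. if p = {#} then 1 else 0)"
  by (rule e_expansionI[where A = "{{#}}"]) (auto simp: partition_def split: if_splits)

text \<open>The factor inserts a part k into every index, so the new coefficient at p is the old one
  after deleting one k. The bound on k keeps the indices partitions.\<close>

lemma e_expansion_elem_sym_mult:
  assumes "e_expansion F c" "k \<ge> 1"
  shows "e_expansion (elem_sym k * F) (\<lambda>p. if k \<in># p then c (p - {#k#}) else 0)"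
proof (rule e_expansionI[where A = "add_mset k ` {p. c p \<noteq> 0}"])
  let ?d = "\<lambda>p. if k \<in># p then c (p - {#k#}) else 0"
  have fin: "finite {p. c p \<noteq> 0}" using assms by (simp add: e_expansion_def)
  then show "finite (add_mset k ` {p. c p \<noteq> 0})" by simp
  show "p \<in> add_mset k ` {p. c p \<noteq> 0} \<and> partition p" if d: "?d p \<noteq> 0" for p
  proof -
    from d obtain q where q: "p = add_mset k q" "c q \<noteq> 0"
      by (auto split: if_splits dest!: multi_member_split)
    then show ?thesis using assms by (auto simp: e_expansion_def partition_def)
  qed
  have "elem_sym k * F = (\<Sum>p | c p \<noteq> 0. smult (c p) (elem_sym_prod (add_mset k p)))"
    using e_expansion_eq_sum[OF assms(1) fin] by (simp add: sum_distrib_left smult_mult_right)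
  also have "\<dots> = (\<Sum>p\<in>add_mset k ` {p. c p \<noteq> 0}. smult (?d p) (elem_sym_prod p))"
    by (subst sum.reindex) (auto simp: inj_on_def)
  finally show "elem_sym k * F = \<dots>" .
qed

text \<open>This makes the description in \<open>e_coeff\<close> proper: the difference of two
  expansions is an expansion of 0.\<close>

lemma e_expansion_unique:
  assumes "e_expansion F c" "e_expansion F d"
  shows "c = d"
proof
  fix p
  have diff: "e_expansion 0 (\<lambda>p. c p - d p)" using e_expansion_diff[OF assms] by simp
  then have "finite {p. c p - d p \<noteq> 0}" "\<forall>p\<in>{p. c p - d p \<noteq> 0}. partition p"
    by (simp_all add: e_expansion_def)
  moreover from this(1) have "(\<Sum>p | c p - d p \<noteq> 0. smult (c p - d p) (elem_sym_prod p)) = 0"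
    using e_expansion_eq_sum[OF diff] by simp
  ultimately have "p \<in> {p. c p - d p \<noteq> 0} \<Longrightarrow> c p - d p = 0"
    by (rule elem_sym_prod_independent)
  then show "c p = d p" by auto
qed

lemma e_coeff_eqI: "e_expansion F c \<Longrightarrow> e_coeff p F = c p"
  unfolding e_coeff_def using e_expansion_unique by (metis the_equality)

text \<open>Guards the rules for \<open>e_coeff\<close>, whose value is unspecified for a series
  without an expansion.\<close>

definition e_expandable :: "mseries \<Rightarrow> bool" where
  "e_expandable F \<longleftrightarrow> (\<exists>c. e_expansion F c)"

lemma e_expandable_ops [intro]:
  "e_expandable 0"
  "e_expandable 1"
  "e_expandable F \<Longrightarrow> e_expandable (smult a F)"
  "e_expandable F \<Longrightarrow> e_expandable G \<Longrightarrow> e_expandable (F + G)"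
  "e_expandable F \<Longrightarrow> e_expandable G \<Longrightarrow> e_expandable (F - G)"
  "e_expandable F \<Longrightarrow> k \<ge> 1 \<Longrightarrow> e_expandable (elem_sym k * F)"
  unfolding e_expandable_def
  by (blast intro: e_expansion_zero e_expansion_one e_expansion_smult e_expansion_add
      e_expansion_diff e_expansion_elem_sym_mult)+

lemma e_expandable_sum [intro]:
  "(\<And>i. i \<in> A \<Longrightarrow> e_expandable (f i)) \<Longrightarrow> e_expandable (sum f A)"
  by (induction A rule: infinite_finite_induct) auto

lemma e_expandable_elem_sym [intro]: "k \<ge> 1 \<Longrightarrow> e_expandable (elem_sym k)"
  using e_expandable_ops(6)[of 1 k] by auto

lemma e_coeff_ops:
  "e_coeff p 0 = 0"
  "e_coeff p 1 = (if p = {#} then 1 else 0)"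
  "e_expandable F \<Longrightarrow> e_coeff p (smult a F) = a * e_coeff p F"
  "e_expandable F \<Longrightarrow> e_expandable G \<Longrightarrow> e_coeff p (F + G) = e_coeff p F + e_coeff p G"
  "e_expandable F \<Longrightarrow> e_expandable G \<Longrightarrow> e_coeff p (F - G) = e_coeff p F - e_coeff p G"
  "e_expandable F \<Longrightarrow> k \<ge> 1 \<Longrightarrow>
    e_coeff p (elem_sym k * F) = (if k \<in># p then e_coeff (p - {#k#}) F else 0)"
  using e_coeff_eqI[OF e_expansion_zero] e_coeff_eqI[OF e_expansion_one]
  by (auto simp: e_expandable_def e_coeff_eqI e_coeff_eqI[OF e_expansion_smult]
      e_coeff_eqI[OF e_expansion_add] e_coeff_eqI[OF e_expansion_diff]
      e_coeff_eqI[OF e_expansion_elem_sym_mult])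

lemma e_coeff_sum:
  "(\<And>i. i \<in> A \<Longrightarrow> e_expandable (f i)) \<Longrightarrow> e_coeff p (sum f A) = (\<Sum>i\<in>A. e_coeff p (f i))"
  by (induction A rule: infinite_finite_induct) (simp_all add: e_coeff_ops e_expandable_sum)

lemma e_coeff_elem_sym:
  assumes "k \<ge> 1"
  shows "e_coeff p (elem_sym k) = (if p = {#k#} then 1 else 0)"
proof -
  have "e_coeff p (elem_sym k) = (if k \<in># p \<and> p - {#k#} = {#} then 1 else 0)"
    using e_coeff_ops(6)[of 1 k p] assms by (simp add: e_coeff_ops e_expandable_ops)
  also have "(k \<in># p \<and> p - {#k#} = {#}) = (p = {#k#})"
    by (auto dest!: multi_member_split)
  finally show ?thesis .
qed

lemma eq_zero_if_e_coeff_zero: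
  assumes "e_expandable F" "\<And>p. partition p \<Longrightarrow> e_coeff p F = 0"
  shows "F = 0"
proof -
  from assms(1) obtain c where c: "e_expansion F c" by (auto simp: e_expandable_def)
  then have "{p. c p \<noteq> 0} = {}"
    using assms(2) e_coeff_eqI[OF c] by (auto simp: e_expansion_def)
  then show ?thesis using e_expansion_eq_sum[OF c, of "{}"] by simp
qed

section \<open>Words\<close>

text \<open>A coloring is encoded as the list of its colors in vertex order. Disjoint unions of
  graphs then become concatenations of words.\<close>

definition word_series :: "nat list set \<Rightarrow> mseries" where
  "word_series W = MSeries (\<lambda>x. of_nat (card {w \<in> W. mset w = x}))"

lemma mcoeff_word_series: "mcoeff (word_series W) x = of_nat (card {w \<in> W. mset w = x})"
  by (simp add: word_series_def MSeries_inverse)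

lemma finite_words_mset: "finite {w \<in> W. mset w = x}"
  by (rule finite_subset[OF _ finite_permutations_of_multiset[of x]])
    (auto intro: permutations_of_multisetI)

lemma word_series_Un:
  assumes "U \<inter> V = {}"
  shows "word_series (U \<union> V) = word_series U + word_series V"
proof (rule mseries_eqI)
  fix x
  have "{w \<in> U \<union> V. mset w = x} = {w \<in> U. mset w = x} \<union> {w \<in> V. mset w = x}" by auto
  then have "card {w \<in> U \<union> V. mset w = x} = card {w \<in> U. mset w = x} + card {w \<in> V. mset w = x}"
    using assms by (auto intro!: card_Un_disjoint finite_words_mset)
  then show "mcoeff (word_series (U \<union> V)) x = mcoeff (word_series U + word_series V) x"
    by (simp add: mcoeff_word_series)
qed

lemma word_series_UN:
  assumes "finite I" "\<And>i j. i \<in> I \<Longrightarrow> j \<in> I \<Longrightarrow> i \<noteq> j \<Longrightarrow> W i \<inter> W j = {}"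
  shows "word_series (\<Union>i\<in>I. W i) = (\<Sum>i\<in>I. word_series (W i))"
  using assms
proof (induction I rule: finite_induct)
  case empty
  then show ?case by (intro mseries_eqI) (simp add: mcoeff_word_series)
next
  case (insert i I)
  then have "W i \<inter> (\<Union>j\<in>I. W j) = {}" by blast
  then show ?case using insert by (simp add: word_series_Un)
qed

lemma word_series_cong_bij:
  assumes "bij_betw f U V" "\<And>w. w \<in> U \<Longrightarrow> mset (f w) = mset w"
  shows "word_series U = word_series V"
proof (rule mseries_eqI)
  fix x
  have "bij_betw f {w \<in> U. mset w = x} {w \<in> V. mset w = x}"
    using assms by (fastforce simp: bij_betw_def inj_on_def)
  then show "mcoeff (word_series U) x = mcoeff (word_series V) x"
    by (simp add: mcoeff_word_series bij_betw_same_card)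
qed

text \<open>The common length k makes the cut of a concatenation unique, so concatenation is a
  bijection from pairs of words.\<close>

lemma word_series_mult:
  assumes "\<And>u. u \<in> U \<Longrightarrow> length u = k"
  shows "word_series U * word_series V = word_series {u @ v | u v. u \<in> U \<and> v \<in> V}"
proof (rule mseries_eqI)
  fix x :: "nat multiset"
  let ?c = "\<lambda>W x. {w \<in> W. mset w = x}"
  let ?P = "{(a, b). a + b = x}"
  let ?Q = "\<lambda>(a, b). ?c U a \<times> ?c V b"
  have "bij_betw (\<lambda>(u, v). u @ v) (\<Union>p\<in>?P. ?Q p) (?c {u @ v | u v. u \<in> U \<and> v \<in> V} x)"
    unfolding bij_betw_def
  proof
    show "inj_on (\<lambda>(u, v). u @ v) (\<Union>p\<in>?P. ?Q p)"
      using assms by (auto simp: inj_on_def)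
    show "(\<lambda>(u, v). u @ v) ` (\<Union>p\<in>?P. ?Q p) = ?c {u @ v | u v. u \<in> U \<and> v \<in> V} x"
      by (auto simp: image_iff)
  qed
  then have "card (?c {u @ v | u v. u \<in> U \<and> v \<in> V} x) = card (\<Union>p\<in>?P. ?Q p)"
    by (simp add: bij_betw_same_card)
  also have "\<dots> = (\<Sum>p\<in>?P. card (?Q p))"
    by (rule card_UN_disjoint) (auto simp: finite_splits finite_words_mset)
  finally show "mcoeff (word_series U * word_series V) x
      = mcoeff (word_series {u @ v | u v. u \<in> U \<and> v \<in> V}) x"
    by (simp add: times_mseries.rep_eq mcoeff_word_series case_prod_unfold card_cartesian_product)
qed

text \<open>Vertex i has its color at position i - 1. Dropping only m - 1 letters keeps the last
  vertex of the complete graph, so the edge that attaches the tail is included.\<close>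

definition lollipop_words :: "nat \<Rightarrow> nat \<Rightarrow> nat list set" where
  "lollipop_words m n = {w. length w = m + n \<and> 0 \<notin> set w \<and>
     distinct (take m w) \<and> distinct_adj (drop (m - 1) w)}"

definition lollipop_series :: "nat \<Rightarrow> nat \<Rightarrow> mseries" where
  "lollipop_series m n = word_series (lollipop_words m n)"

definition path_series :: "nat \<Rightarrow> mseries" where
  "path_series l = word_series {w. length w = l \<and> 0 \<notin> set w \<and> distinct_adj w}"

lemma lollipop_series_1: "lollipop_series 1 n = path_series (Suc n)"
proof -
  have "distinct (take (Suc 0) w)" for w :: "nat list" by (cases w) auto
  then show ?thesis
    by (simp add: lollipop_series_def path_series_def lollipop_words_def)
qed

text \<open>Every k-subset of colors is the content of exactly k! words, its arrangements.\<close>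

lemma word_series_distinct:
  "word_series {w. length w = k \<and> 0 \<notin> set w \<and> distinct w} = smult (fact k) (elem_sym k)"
    (is "word_series ?D = _")
proof (rule mseries_eqI)
  fix x
  show "mcoeff (word_series ?D) x = mcoeff (smult (fact k) (elem_sym k)) x"
  proof (cases "x \<in> mset_set ` {S. finite S \<and> S \<subseteq> {1..} \<and> card S = k}")
    case True
    then obtain S where S: "x = mset_set S" "finite S" "S \<subseteq> {1..}" "card S = k" by auto
    have "{w \<in> ?D. mset w = x} = permutations_of_set S"
    proof (intro equalityI subsetI)
      fix w assume "w \<in> {w \<in> ?D. mset w = x}"
      then show "w \<in> permutations_of_set S"
        using S by (auto simp: permutations_of_set_def)
          (metis finite_set_mset_mset_set set_mset_mset)+
    next
      fix w assume "w \<in> permutations_of_set S"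
      then have "set w = S" "distinct w" by (auto simp: permutations_of_set_def)
      then show "w \<in> {w \<in> ?D. mset w = x}"
        using S by (auto simp: distinct_card mset_set_set)
    qed
    then show ?thesis
      using True S by (simp add: mcoeff_word_series elem_sym.rep_eq)
  next
    case False
    have "{w \<in> ?D. mset w = x} = {}"
    proof (rule ccontr)
      assume "\<not> ?thesis"
      then obtain w where w: "length w = k" "0 \<notin> set w" "distinct w" "x = mset w" by auto
      then have "x = mset_set (set w)" "card (set w) = k" "set w \<subseteq> {1..}"
        by (auto simp: mset_set_set distinct_card Suc_le_eq intro!: gr0I)
      then show False using False by auto
    qed
    then have "mcoeff (word_series ?D) x = 0" by (simp only: mcoeff_word_series card.empty of_nat_0)
    then show ?thesis using False by (simp add: elem_sym.rep_eq)
  qed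
qed

lemma lollipop_series_0:
  assumes "m \<ge> 1"
  shows "lollipop_series m 0 = smult (fact m) (elem_sym m)"
proof -
  have "distinct_adj (drop (m - 1) w)" if "length w = m" for w :: "nat list"
  proof -
    have "length (drop (m - 1) w) = Suc 0" using that assms by simp
    then obtain a where "drop (m - 1) w = [a]" by (metis length_0_conv length_Suc_conv)
    then show ?thesis by simp
  qed
  then have "lollipop_words m 0 = {w. length w = m \<and> 0 \<notin> set w \<and> distinct w}"
    by (auto simp: lollipop_words_def)
  then show ?thesis by (simp add: lollipop_series_def word_series_distinct)
qed

text \<open>
  Both lollipops below arise from a complete graph on \<open>k\<close> vertices and a disjoint path on \<open>n + 1\<close>
  vertices by adding edges from the first path vertex to the complete graph: to all its vertices for
  \<open>L\<^bsub>k+1,n\<^esub>\<close>, to just one for \<open>L\<^bsub>k,n+1\<^esub>\<close>. A coloring violates at most one of these edges, and by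
  symmetry each of them is violated equally often.
\<close>

lemma lollipop_series_rec:
  assumes "k \<ge> 1"
  shows "lollipop_series (Suc k) n = smult (of_nat k)
    (lollipop_series k (Suc n) - smult (of_nat (k - 1) * fact (k - 1)) (elem_sym k * path_series (Suc n)))"
proof -
  \<comment> \<open>\<open>A\<close> imposes no condition between the complete graph and the path,
    whose first vertex is at position k. \<open>B i\<close> consists of the words that violate the
    edge from position i to it.\<close>
  define A where "A = {w :: nat list. length w = k + Suc n \<and> 0 \<notin> set w \<and>
    distinct (take k w) \<and> distinct_adj (drop k w)}"
  define B where "B i = {w \<in> A. w ! i = w ! k}" for i
  have "{u @ v | u v. u \<in> {w. length w = k \<and> 0 \<notin> set w \<and> distinct w} \<and>
      v \<in> {w. length w = Suc n \<and> 0 \<notin> set w \<and> distinct_adj w}} = A" (is "?C = A")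
  proof (intro equalityI subsetI)
    fix w assume "w \<in> A"
    then have "w = take k w @ drop k w" "length (take k w) = k" "length (drop k w) = Suc n"
      "0 \<notin> set (take k w)" "0 \<notin> set (drop k w)" "distinct (take k w)" "distinct_adj (drop k w)"
      by (auto simp: A_def dest: in_set_takeD in_set_dropD)
    then show "w \<in> ?C" by blast
  qed (auto simp: A_def)
  then have A_mult: "word_series A = smult (fact k) (elem_sym k * path_series (Suc n))"
    using word_series_mult[of "{w. length w = k \<and> 0 \<notin> set w \<and> distinct w}" k
        "{w. length w = Suc n \<and> 0 \<notin> set w \<and> distinct_adj w}"]
    by (simp add: word_series_distinct path_series_def smult_mult_left)
  have in_take: "w ! k \<in> set (take k w) \<longleftrightarrow> (\<exists>i<k. w ! i = w ! k)" if "w \<in> A" for w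
    using that by (auto simp: A_def in_set_conv_nth)
  have take_Suc: "take (Suc k) w = take k w @ [w ! k]" if "length w = k + Suc n" for w :: "nat list"
    using that by (simp add: take_Suc_conv_app_nth)
  have "distinct_adj (drop (k - 1) w) \<longleftrightarrow> w ! (k - 1) \<noteq> w ! k \<and> distinct_adj (drop k w)"
    if "length w = k + Suc n" for w :: "nat list"
  proof -
    have "drop (k - 1) w = w ! (k - 1) # drop k w" "drop k w = w ! k # drop (Suc k) w"
      using that assms Cons_nth_drop_Suc[of "k - 1" w] Cons_nth_drop_Suc[of k w] by auto
    then show ?thesis by (metis distinct_adj_Cons_Cons)
  qed
  \<comment> \<open>For \<open>L_{k,n+1}\<close> only the edge from position k - 1 is added; for
    \<open>L_{k+1,n}\<close> all edges from positions below k are added.\<close>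
  then have A_eq1: "A = lollipop_words k (Suc n) \<union> B (k - 1)"
    and disj1: "lollipop_words k (Suc n) \<inter> B (k - 1) = {}"
    by (auto simp: A_def B_def lollipop_words_def)
  have A_eq2: "A = lollipop_words (Suc k) n \<union> (\<Union>i<k. B i)"
    and disj2: "lollipop_words (Suc k) n \<inter> (\<Union>i<k. B i) = {}"
    using in_take take_Suc by (auto simp: B_def lollipop_words_def) (auto simp: A_def)
  \<comment> \<open>The letters before position k are distinct, so at most one of them equals the
    letter at k.\<close>
  have B_disj: "B i \<inter> B j = {}" if "i < k" "j < k" "i \<noteq> j" for i j
  proof -
    have "w ! i \<noteq> w ! j" if "w \<in> A" for w
      using that \<open>i < k\<close> \<open>j < k\<close> \<open>i \<noteq> j\<close> nth_eq_iff_index_eq[of "take k w" i j]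
      by (simp add: A_def)
    then show ?thesis by (force simp: B_def)
  qed
  have B_eq: "word_series (B i) = word_series (B (k - 1))" if i: "i < k" for i
  proof -
    \<comment> \<open>Exchanging the letters i and k - 1 keeps the content, the distinctness of the
      first k letters and everything from position k on, while it moves the violation from i to k -
      1.\<close>
    define swap where "swap w = w[i := w ! (k - 1), k - 1 := w ! i]" for w :: "nat list"
    have invol: "swap (swap w) = w" if "w \<in> A" for w
      using that i by (auto simp: swap_def A_def nth_list_update intro!: nth_equalityI)
    have swap_mset: "mset (swap w) = mset w" if "w \<in> A" for w
      using that i unfolding swap_def by (intro mset_swap) (auto simp: A_def)
    have swap_A: "swap w \<in> A" if w: "w \<in> A" for w
    proof -
      have "take k (swap w) = (take k w)[i := take k w ! (k - 1), k - 1 := take k w ! i]"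
        using i by (simp add: swap_def take_update_swap)
      then have "distinct (take k (swap w))"
        using w i distinct_swap[of i "take k w" "k - 1"] by (simp add: A_def)
      moreover have "drop k (swap w) = drop k w"
        using i by (simp add: swap_def)
      moreover have "set (swap w) = set w"
        using swap_mset[OF w] by (metis set_mset_mset)
      ultimately show ?thesis using w by (simp add: A_def swap_def)
    qed
    have swap_nth: "swap w ! k = w ! k" "swap w ! i = w ! (k - 1)" "swap w ! (k - 1) = w ! i"
      if "w \<in> A" for w
      using that i by (auto simp: swap_def A_def nth_list_update)
    have "bij_betw swap (B i) (B (k - 1))"
      by (rule bij_betw_byWitness[where f' = swap])
        (auto simp: B_def invol swap_A swap_nth simp del: One_nat_def)
    then show ?thesis
      by (rule word_series_cong_bij) (auto simp: B_def swap_mset)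
  qed
  have "word_series (\<Union>i<k. B i) = (\<Sum>i<k. word_series (B i))"
    using B_disj by (intro word_series_UN) auto
  also have "\<dots> = (\<Sum>i<k. word_series (B (k - 1)))"
    by (intro sum.cong refl B_eq) simp
  also have "\<dots> = smult (of_nat k) (word_series (B (k - 1)))"
    by (rule mseries_eqI) (simp only: mcoeff_sum mcoeff_simps, simp)
  finally have "word_series A
      = lollipop_series (Suc k) n + smult (of_nat k) (word_series (B (k - 1)))"
    by (subst A_eq2) (simp only: lollipop_series_def word_series_Un[OF disj2])
  moreover have "word_series A = lollipop_series k (Suc n) + word_series (B (k - 1))"
    by (subst A_eq1) (simp only: lollipop_series_def word_series_Un[OF disj1])
  \<comment> \<open>The two decompositions of \<open>A\<close> involve the same series of
    \<open>B (k - 1)\<close>, once with factor k and once with factor 1; it is eliminated.\<close>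
  ultimately have eq: "lollipop_series (Suc k) n
      = word_series A - smult (of_nat k) (word_series A - lollipop_series k (Suc n))"
    by (metis add_diff_cancel_left' add_diff_cancel_right')
  \<comment> \<open>Writing k as a successor removes the truncated subtraction in k - 1 before
    comparing coefficients.\<close>
  obtain i where k: "k = Suc i" using assms by (cases k) auto
  show ?thesis
    unfolding eq A_mult unfolding k by (rule mseries_eqI) (simp add: algebra_simps)
qed

section \<open>Expansions of paths and lollipops\<close>

text \<open>The decrease of \<open>X(L_{j,N-j}) / (j-1)!\<close> when j grows by one. It vanishes
  for j = 1, in accordance with \<open>L_{1,N-1}\<close> and \<open>L_{2,N-2}\<close> both being
  paths.\<close>

definition lollipop_term :: "nat \<Rightarrow> nat \<Rightarrow> mseries" where
  "lollipop_term N j = smult (of_nat (j - 1)) (elem_sym j * path_series (N - j))"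

text \<open>Divided by the factorial, the recurrence telescopes from the path at k = 1.\<close>

lemma lollipop_series_eq_path_diff:
  assumes "1 \<le> k" "k \<le> N"
  shows "lollipop_series k (N - k)
    = smult (fact (k - 1)) (path_series N - (\<Sum>j\<in>{1..<k}. lollipop_term N j))"
  using assms
proof (induction k rule: nat_induct_at_least)
  case base
  then show ?case using lollipop_series_1[of "N - 1"] by simp
next
  case (Suc k)
  have N: "N - k = Suc (N - Suc k)" using Suc.prems by simp
  have f: "fact k = of_nat k * (fact (k - 1) :: rat)" using Suc.hyps by (simp add: fact_reduce)
  have "lollipop_series (Suc k) (N - Suc k) = smult (of_nat k)
    (lollipop_series k (N - k) - smult (of_nat (k - 1) * fact (k - 1)) (elem_sym k * path_series (N - k)))"
    unfolding N using Suc.hyps by (rule lollipop_series_rec)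
  also have "lollipop_series k (N - k)
      = smult (fact (k - 1)) (path_series N - (\<Sum>j\<in>{1..<k}. lollipop_term N j))"
    using Suc by simp
  also have "smult (of_nat (k - 1) * fact (k - 1)) (elem_sym k * path_series (N - k))
      = smult (fact (k - 1)) (lollipop_term N k)"
    by (simp add: lollipop_term_def mult.commute)
  finally show ?case
    using Suc.hyps by (simp add: f smult_diff_right smult_add_right algebra_simps)
qed

text \<open>At k = N the telescoped formula must give the complete graph, that is
  \<open>N! e_N\<close>; solving for the path yields a recursion through shorter paths.\<close>

lemma path_series_eq:
  assumes "N \<ge> 1"
  shows "path_series N = smult (of_nat N) (elem_sym N) + (\<Sum>j\<in>{1..<N}. lollipop_term N j)"
proof -
  have "smult (fact (N - 1)) (smult (of_nat N) (elem_sym N)) = lollipop_series N 0"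
    using assms lollipop_series_0[of N] by (simp add: fact_reduce mult.commute)
  also have "\<dots> = smult (fact (N - 1)) (path_series N - (\<Sum>j\<in>{1..<N}. lollipop_term N j))"
    using lollipop_series_eq_path_diff[of N N] assms by simp
  finally have "smult (of_nat N) (elem_sym N) = path_series N - (\<Sum>j\<in>{1..<N}. lollipop_term N j)"
    using smult_cancel[of "fact (N - 1)"] fact_nonzero by blast
  then show ?thesis by simp
qed

lemma lollipop_series_eq:
  assumes "1 \<le> k" "k \<le> N"
  shows "lollipop_series k (N - k)
    = smult (fact (k - 1)) (smult (of_nat N) (elem_sym N) + (\<Sum>j\<in>{k..<N}. lollipop_term N j))"
proof -
  have "(\<Sum>j\<in>{1..<N}. lollipop_term N j)
      = (\<Sum>j\<in>{1..<k}. lollipop_term N j) + (\<Sum>j\<in>{k..<N}. lollipop_term N j)"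
    using assms by (simp add: sum.atLeastLessThan_concat)
  then show ?thesis
    using lollipop_series_eq_path_diff[OF assms] path_series_eq[of N] assms by simp
qed

text \<open>The properties of the path are assumptions here because the induction for paths uses
  this result. The coefficient at \<open>{#N#}\<close> vanishes since this index has no part j <
  N.\<close>

lemma lollipop_term_expansion_if_path:
  assumes path: "e_expandable (path_series (N - j))" "\<And>p. e_coeff p (path_series (N - j)) \<ge> 0"
    and j: "1 \<le> j" "j < N"
  shows "e_expandable (lollipop_term N j)"
    and "e_coeff p (lollipop_term N j) \<ge> 0"
    and "e_coeff {#N#} (lollipop_term N j) = 0"
proof -
  have E: "e_expandable (elem_sym j * path_series (N - j))"
    using path(1) j(1) by (rule e_expandable_ops)
  then show "e_expandable (lollipop_term N j)"
    unfolding lollipop_term_def by (rule e_expandable_ops)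
  have coeff: "e_coeff p (lollipop_term N j)
      = of_nat (j - 1) * (if j \<in># p then e_coeff (p - {#j#}) (path_series (N - j)) else 0)" for p
    unfolding lollipop_term_def e_coeff_ops(3)[OF E] e_coeff_ops(6)[OF path(1) j(1)] ..
  show "e_coeff p (lollipop_term N j) \<ge> 0"
    unfolding coeff using path(2) by (intro mult_nonneg_nonneg) auto
  show "e_coeff {#N#} (lollipop_term N j) = 0"
    unfolding coeff using j by simp
qed

text \<open>Strong induction: \<open>path_series_eq\<close> involves only shorter nonempty paths,
  all with nonnegative factors.\<close>

lemma path_series_expansion:
  "N \<ge> 1 \<Longrightarrow> e_expandable (path_series N) \<and> (\<forall>p. e_coeff p (path_series N) \<ge> 0)"
proof (induction N rule: less_induct)
  case (less N)
  have T: "e_expandable (lollipop_term N j)" "e_coeff p (lollipop_term N j) \<ge> 0"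
    if "j \<in> {1..<N}" for j p
    using that less.IH[of "N - j"] by (auto intro!: lollipop_term_expansion_if_path)
  have S: "e_expandable (\<Sum>j\<in>{1..<N}. lollipop_term N j)"
    using T(1) by (rule e_expandable_sum)
  have E: "e_expandable (elem_sym N)" using less.prems by (rule e_expandable_elem_sym)
  have "e_coeff p (path_series N)
      = of_nat N * e_coeff p (elem_sym N) + (\<Sum>j\<in>{1..<N}. e_coeff p (lollipop_term N j))" for p
    unfolding path_series_eq[OF less.prems] e_coeff_ops(4)[OF e_expandable_ops(3)[OF E] S]
      e_coeff_ops(3)[OF E] by (simp only: e_coeff_sum T)
  moreover have "e_coeff p (elem_sym N) \<ge> 0" for p
    unfolding e_coeff_elem_sym[OF less.prems] by simp
  ultimately have "e_coeff p (path_series N) \<ge> 0" for p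
    using T(2) by (auto intro!: add_nonneg_nonneg sum_nonneg)
  moreover have "e_expandable (path_series N)"
    unfolding path_series_eq[OF less.prems] using E S by auto
  ultimately show ?case by blast
qed

lemma lollipop_term_expansion:
  assumes "j \<in> {1..<N}"
  shows "e_expandable (lollipop_term N j)"
    and "e_coeff p (lollipop_term N j) \<ge> 0"
    and "e_coeff {#N#} (lollipop_term N j) = 0"
  using assms path_series_expansion[of "N - j"]
  by (auto intro!: lollipop_term_expansion_if_path)

text \<open>Supplies the normalizing constants of \<open>X_e\<close>: only the summand
  \<open>N e_N\<close> contributes to the coefficient of \<open>e_N\<close>.\<close>

lemma lollipop_series_expansion:
  assumes "1 \<le> k" "k \<le> N"
  shows "e_expandable (lollipop_series k (N - k))"
    and "e_coeff {#N#} (lollipop_series k (N - k)) = fact (k - 1) * of_nat N"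
proof -
  have "e_expandable (\<Sum>j\<in>{k..<N}. lollipop_term N j)"
    using assms by (auto intro!: lollipop_term_expansion)
  moreover have "e_coeff {#N#} (\<Sum>j\<in>{k..<N}. lollipop_term N j) = 0"
    using assms by (subst e_coeff_sum) (auto simp: lollipop_term_expansion)
  moreover have "e_expandable (elem_sym N)" using assms by auto
  ultimately show "e_expandable (lollipop_series k (N - k))"
    and "e_coeff {#N#} (lollipop_series k (N - k)) = fact (k - 1) * of_nat N"
    unfolding lollipop_series_eq[OF assms]
    using assms by (auto simp: e_coeff_ops e_expandable_ops e_coeff_elem_sym)
qed

section \<open>Lollipop graphs\<close>

lemma verts_lollipop [simp]: "verts (lollipop m n) = {1..m + n}"
  by (simp add: lollipop_def)

lemma proper_colorings_lollipop:
  "\<kappa> \<in> proper_colorings (lollipop m n) \<longleftrightarrow> \<kappa> \<in> {1..m + n} \<rightarrow>\<^sub>E {1..} \<and>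
    inj_on \<kappa> {1..m} \<and> (\<forall>i. m \<le> i \<and> i < m + n \<longrightarrow> \<kappa> i \<noteq> \<kappa> (Suc i))"
proof -
  have "(\<forall>u v. {u, v} \<in> edges (lollipop m n) \<longrightarrow> \<kappa> u \<noteq> \<kappa> v) \<longleftrightarrow>
    inj_on \<kappa> {1..m} \<and> (\<forall>i. m \<le> i \<and> i < m + n \<longrightarrow> \<kappa> i \<noteq> \<kappa> (Suc i))" (is "?P \<longleftrightarrow> ?Q \<and> ?R")
  proof (intro iffI conjI)
    assume P: ?P
    show ?Q
    proof (rule inj_onI, rule ccontr)
      fix u v assume "u \<in> {1..m}" "v \<in> {1..m}" "\<kappa> u = \<kappa> v" "u \<noteq> v"
      moreover from this have "{u, v} \<in> edges (lollipop m n)" unfolding lollipop_def by auto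
      ultimately show False using P by blast
    qed
    show ?R
    proof (intro allI impI)
      fix i assume "m \<le> i \<and> i < m + n"
      then have "{i, Suc i} \<in> edges (lollipop m n)" unfolding lollipop_def by auto
      then show "\<kappa> i \<noteq> \<kappa> (Suc i)" using P by blast
    qed
  next
    assume QR: "?Q \<and> ?R"
    show ?P
    proof (intro allI impI)
      fix u v assume "{u, v} \<in> edges (lollipop m n)"
      then consider i j where "{u, v} = {i, j}" "i \<in> {1..m}" "j \<in> {1..m}" "i \<noteq> j"
        | i where "{u, v} = {i, Suc i}" "m \<le> i" "i < m + n"
        unfolding lollipop_def by auto
      then show "\<kappa> u \<noteq> \<kappa> v"
      proof cases
        case 1
        then have "\<kappa> i \<noteq> \<kappa> j" using QR by (auto dest: inj_onD)
        then show ?thesis using 1(1) by (metis doubleton_eq_iff)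
      next
        case 2
        then have "\<kappa> i \<noteq> \<kappa> (Suc i)" using QR by blast
        then show ?thesis using 2(1) by (metis doubleton_eq_iff)
      qed
    qed
  qed
  then show ?thesis by (simp add: proper_colorings_def)
qed

text \<open>Rephrases the conditions on words in terms of vertices numbered from 1, to match
  \<open>proper_colorings_lollipop\<close>.\<close>

lemma lollipop_words_iff:
  assumes "m \<ge> 1"
  shows "w \<in> lollipop_words m n \<longleftrightarrow> length w = m + n \<and> 0 \<notin> set w \<and>
    inj_on (\<lambda>i. w ! (i - 1)) {1..m} \<and> (\<forall>i. m \<le> i \<and> i < m + n \<longrightarrow> w ! (i - 1) \<noteq> w ! i)"
proof (cases "length w = m + n")
  case len: True
  have "distinct (take m w) \<longleftrightarrow> inj_on ((!) w) {..<m}"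
    using len by (auto simp: distinct_conv_nth inj_on_def)
  also have "{..<m} = (\<lambda>i. i - 1) ` {1..m}"
    by (auto simp: image_iff intro!: bexI[of _ "Suc _"])
  also have "inj_on ((!) w) \<dots> \<longleftrightarrow> inj_on (\<lambda>i. w ! (i - 1)) {1..m}"
    by (subst comp_inj_on_iff) (auto simp: inj_on_def o_def)
  finally have 1: "distinct (take m w) \<longleftrightarrow> inj_on (\<lambda>i. w ! (i - 1)) {1..m}" .
  \<comment> \<open>The dropped word has n + 1 letters, hence n adjacent pairs; pair i is the edge
    between the vertices m + i and m + i + 1.\<close>
  have "distinct_adj (drop (m - 1) w) \<longleftrightarrow> (\<forall>i<n. w ! (m - 1 + i) \<noteq> w ! (m + i))"
    using len assms by (auto simp: distinct_adj_conv_nth)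
  also have "\<dots> \<longleftrightarrow> (\<forall>i. m \<le> i \<and> i < m + n \<longrightarrow> w ! (i - 1) \<noteq> w ! i)"
  proof (intro iffI allI impI)
    fix i assume "\<forall>i<n. w ! (m - 1 + i) \<noteq> w ! (m + i)" "m \<le> i \<and> i < m + n"
    then show "w ! (i - 1) \<noteq> w ! i" using assms by (auto dest!: spec[of _ "i - m"])
  next
    fix i assume "\<forall>i. m \<le> i \<and> i < m + n \<longrightarrow> w ! (i - 1) \<noteq> w ! i" "i < n"
    then show "w ! (m - 1 + i) \<noteq> w ! (m + i)" using assms by (auto dest!: spec[of _ "m + i"])
  qed
  finally show ?thesis using 1 len by (simp add: lollipop_words_def)
qed (simp add: lollipop_words_def)

lemma chrom_sym_lollipop:
  assumes "m \<ge> 1"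
  shows "chrom_sym (lollipop m n) = lollipop_series m n"
proof (rule mseries_eqI)
  fix x
  let ?N = "m + n"
  let ?word = "\<lambda>\<kappa> :: nat \<Rightarrow> nat. map \<kappa> [1..<Suc ?N]"
  \<comment> \<open>The restriction makes the coloring undefined off the vertex set, as the
    extensional function space requires.\<close>
  let ?col = "\<lambda>w :: nat list. restrict (\<lambda>i. w ! (i - 1)) {1..?N}"
  have nth: "?word \<kappa> ! i = \<kappa> (Suc i)" if "i < ?N" for \<kappa> i
    using that by (simp del: upt_Suc)
  have mset_word: "mset (?word \<kappa>) = image_mset \<kappa> (mset_set {1..?N})" for \<kappa>
    by (simp add: atLeastLessThanSuc_atLeastAtMost del: upt_Suc)
  have word_col: "?word (?col w) = w" if "length w = ?N" for w
    using that by (intro nth_equalityI) (auto simp: nth simp del: upt_Suc)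
  have col_word: "?col (?word \<kappa>) = \<kappa>" if "\<kappa> \<in> {1..?N} \<rightarrow>\<^sub>E {1..}" for \<kappa>
    using that by (intro ext) (auto simp: nth PiE_def extensional_def restrict_def simp del: upt_Suc)
  have word: "?word \<kappa> \<in> lollipop_words m n" if \<kappa>: "\<kappa> \<in> proper_colorings (lollipop m n)" for \<kappa>
  proof -
    have "length (?word \<kappa>) = ?N" by (simp del: upt_Suc)
    moreover have "0 \<notin> set (?word \<kappa>)"
      using \<kappa> by (force simp: proper_colorings_lollipop PiE_def Pi_def simp del: upt_Suc)
    moreover have "inj_on (\<lambda>i. ?word \<kappa> ! (i - 1)) {1..m} \<longleftrightarrow> inj_on \<kappa> {1..m}"
      by (intro inj_on_cong) (auto simp: nth simp del: upt_Suc)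
    moreover have "?word \<kappa> ! (i - 1) \<noteq> ?word \<kappa> ! i" if "m \<le> i" "i < ?N" for i
      using that assms \<kappa> nth[of "i - 1" \<kappa>] nth[of i \<kappa>]
      by (simp add: proper_colorings_lollipop del: upt_Suc)
    ultimately show ?thesis
      using \<kappa> unfolding lollipop_words_iff[OF assms] proper_colorings_lollipop by blast
  qed
  have col: "?col w \<in> proper_colorings (lollipop m n)" if w: "w \<in> lollipop_words m n" for w
  proof -
    have "w ! (i - 1) \<ge> 1" if "i \<in> {1..?N}" for i
    proof -
      have "w ! (i - 1) \<in> set w" using w that by (intro nth_mem) (auto simp: lollipop_words_def)
      then show ?thesis using w by (auto simp: lollipop_words_def Suc_le_eq intro!: gr0I)
    qed
    moreover have "inj_on (?col w) {1..m} \<longleftrightarrow> inj_on (\<lambda>i. w ! (i - 1)) {1..m}"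
      by (intro inj_on_cong) auto
    ultimately show ?thesis
      using w assms unfolding lollipop_words_iff[OF assms] proper_colorings_lollipop
      by auto
  qed
  have "bij_betw ?word {\<kappa> \<in> proper_colorings (lollipop m n). image_mset \<kappa> (mset_set {1..?N}) = x}
      {w \<in> lollipop_words m n. mset w = x}"
  proof (rule bij_betw_byWitness[where f' = ?col])
    show "?word ` {\<kappa> \<in> proper_colorings (lollipop m n). image_mset \<kappa> (mset_set {1..?N}) = x}
        \<subseteq> {w \<in> lollipop_words m n. mset w = x}"
      using word mset_word by blast
    show "?col ` {w \<in> lollipop_words m n. mset w = x}
        \<subseteq> {\<kappa> \<in> proper_colorings (lollipop m n). image_mset \<kappa> (mset_set {1..?N}) = x}"
    proof clarify
      fix w assume w: "w \<in> lollipop_words m n" "x = mset w"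
      then have "length w = ?N" by (simp add: lollipop_words_def)
      then show "?col w \<in> proper_colorings (lollipop m n) \<and>
          image_mset (?col w) (mset_set {1..?N}) = mset w"
        using col[OF w(1)] word_col mset_word[of "?col w"] by metis
    qed
    show "\<forall>\<kappa>\<in>{\<kappa> \<in> proper_colorings (lollipop m n). image_mset \<kappa> (mset_set {1..?N}) = x}.
        ?col (?word \<kappa>) = \<kappa>"
      using col_word by (simp add: proper_colorings_lollipop del: upt_Suc)
    show "\<forall>w\<in>{w \<in> lollipop_words m n. mset w = x}. ?word (?col w) = w"
      using word_col by (auto simp: lollipop_words_def simp del: upt_Suc)
  qed
  then show "mcoeff (chrom_sym (lollipop m n)) x = mcoeff (lollipop_series m n) x"
    by (simp add: chrom_sym.rep_eq lollipop_series_def mcoeff_word_series bij_betw_same_card)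
qed

text \<open>A coloring that uses \<open>N\<close> distinct colors is proper for every graph.\<close>

lemma mcoeff_lollipop_series_squarefree:
  "mcoeff (lollipop_series m n) (mset_set {1..m + n}) = fact (m + n)"
proof -
  have "{w \<in> lollipop_words m n. mset w = mset_set {1..m + n}} = permutations_of_set {1..m + n}"
  proof (intro equalityI subsetI)
    fix w assume "w \<in> {w \<in> lollipop_words m n. mset w = mset_set {1..m + n}}"
    then have "mset w = mset_set {1..m + n}" by simp
    then have "set w = {1..m + n}" "length w = m + n"
      by (metis finite_atLeastAtMost finite_set_mset_mset_set set_mset_mset,
          metis card_atLeastAtMost diff_Suc_1 size_mset size_mset_set)
    then show "w \<in> permutations_of_set {1..m + n}"
      by (auto simp: permutations_of_set_def intro!: card_distinct)
  next
    fix w assume "w \<in> permutations_of_set {1..m + n}"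
    then have w: "set w = {1..m + n}" "distinct w" by (auto simp: permutations_of_set_def)
    then have "length w = m + n" using distinct_card[of w] by simp
    moreover have "mset w = mset_set {1..m + n}" using w mset_set_set[of w] by simp
    ultimately show "w \<in> {w \<in> lollipop_words m n. mset w = mset_set {1..m + n}}"
      using w by (auto simp: lollipop_words_def distinct_adj_conv_nth nth_eq_iff_index_eq)
  qed
  then show ?thesis by (simp add: lollipop_series_def mcoeff_word_series)
qed

lemma lollipop_connected:
  assumes "m \<ge> 1"
  shows "lollipop m n \<in> connected_graphs (m + n)"
proof -
  let ?R = "{(a, b). {a, b} \<in> edges (lollipop m n)}"
  have "{u, v} \<in> {{u, v} | u v. u \<in> {1..m + n} \<and> v \<in> {1..m + n} \<and> u \<noteq> v}"
    if "u \<in> {1..m + n}" "v \<in> {1..m + n}" "u \<noteq> v" for u v :: nat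
    using that by blast
  then have "edges (lollipop m n) \<subseteq> {{u, v} | u v. u \<in> {1..m + n} \<and> v \<in> {1..m + n} \<and> u \<noteq> v}"
    using assms unfolding lollipop_def snd_conv by (intro subsetI) (elim UnE CollectE exE conjE, simp_all)
  then have "simple_graph (lollipop m n)"
    by (simp add: simple_graph_def)
  \<comment> \<open>Consecutive numbers are adjacent in the complete part as well as in the tail, so
    every vertex is reached from 1 by counting up.\<close>
  moreover have step: "(i, Suc i) \<in> ?R" if "1 \<le> i" "i < m + n" for i
  proof (cases "i < m")
    case True
    then have "i \<in> {1..m}" "Suc i \<in> {1..m}" "i \<noteq> Suc i" using that by auto
    then show ?thesis unfolding lollipop_def snd_conv mem_Collect_eq case_prod_conv by blast
  next
    case False
    then show ?thesis using that unfolding lollipop_def by auto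
  qed
  have reach: "(1, v) \<in> ?R\<^sup>*" if "1 \<le> v" "v \<le> m + n" for v
    using that
  proof (induction v rule: nat_induct_at_least)
    case (Suc v)
    then show ?case using step[of v] by (meson Suc_leD Suc_le_lessD rtrancl.rtrancl_into_rtrancl)
  qed simp
  have "sym (?R\<^sup>*)"
    by (intro sym_rtrancl) (auto simp: sym_def insert_commute)
  then have "(u, v) \<in> ?R\<^sup>*" if "u \<in> {1..m + n}" "v \<in> {1..m + n}" for u v
    using reach that by (meson atLeastAtMost_iff rtrancl_trans symD)
  ultimately show ?thesis
    using assms by (simp add: connected_graphs_def connected_graph_def)
qed

lemma path_graph_eq_lollipop: "N \<ge> 1 \<Longrightarrow> path_graph N = lollipop 1 (N - 1)"
  by (auto simp: path_graph_def lollipop_def)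

lemma complete_graph_eq_lollipop: "complete_graph N = lollipop N 0"
  by (auto simp: complete_graph_def lollipop_def)

section \<open>The order on lollipop classes\<close>

text \<open>The ratio of the coefficients of \<open>e_N\<close> is (a-1)!/(b-1)!, which matches the
  prefactors of both series and cancels the terms \<open>N e_N\<close>.\<close>

lemma X_e_lollipop:
  assumes "1 \<le> a" "a \<le> N" "1 \<le> b" "b \<le> N"
  shows "X_e (lollipop a (N - a)) (lollipop b (N - b)) = smult (fact (a - 1))
    ((\<Sum>j\<in>{a..<N}. lollipop_term N j) - (\<Sum>j\<in>{b..<N}. lollipop_term N j))"
proof -
  have "X_e (lollipop a (N - a)) (lollipop b (N - b)) = lollipop_series a (N - a)
      - smult (fact (a - 1) / fact (b - 1)) (lollipop_series b (N - b))"
    using assms by (simp add: X_e_def chrom_sym_lollipop lollipop_series_expansion)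
  also have "\<dots> = smult (fact (a - 1))
    ((\<Sum>j\<in>{a..<N}. lollipop_term N j) - (\<Sum>j\<in>{b..<N}. lollipop_term N j))"
    unfolding lollipop_series_eq[OF assms(1,2)] lollipop_series_eq[OF assms(3,4)]
    by (simp add: smult_diff_right smult_add_right)
  finally show ?thesis .
qed

lemma X_e_lollipop_le:
  assumes "1 \<le> a" "a \<le> b" "b \<le> N"
  shows "X_e (lollipop a (N - a)) (lollipop b (N - b))
    = smult (fact (a - 1)) (\<Sum>j\<in>{a..<b}. lollipop_term N j)"
    and "X_e (lollipop b (N - b)) (lollipop a (N - a))
    = smult (- fact (b - 1)) (\<Sum>j\<in>{a..<b}. lollipop_term N j)"
proof -
  have "(\<Sum>j\<in>{a..<N}. lollipop_term N j)
      = (\<Sum>j\<in>{a..<b}. lollipop_term N j) + (\<Sum>j\<in>{b..<N}. lollipop_term N j)"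
    using assms by (simp add: sum.atLeastLessThan_concat)
  then show "X_e (lollipop a (N - a)) (lollipop b (N - b))
    = smult (fact (a - 1)) (\<Sum>j\<in>{a..<b}. lollipop_term N j)"
    and "X_e (lollipop b (N - b)) (lollipop a (N - a))
    = smult (- fact (b - 1)) (\<Sum>j\<in>{a..<b}. lollipop_term N j)"
    using assms by (auto simp: X_e_lollipop intro: mseries_eqI)
qed

lemma lollipop_terms_expansion:
  assumes "1 \<le> a" "b \<le> N"
  shows "e_expandable (\<Sum>j\<in>{a..<b}. lollipop_term N j)"
    and "e_coeff p (\<Sum>j\<in>{a..<b}. lollipop_term N j) \<ge> 0"
proof -
  have T: "e_expandable (lollipop_term N j)" "e_coeff p (lollipop_term N j) \<ge> 0"
    if "j \<in> {a..<b}" for j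
    using that assms by (auto intro!: lollipop_term_expansion)
  then show "e_expandable (\<Sum>j\<in>{a..<b}. lollipop_term N j)" by blast
  show "e_coeff p (\<Sum>j\<in>{a..<b}. lollipop_term N j) \<ge> 0"
    using T by (subst e_coeff_sum) (auto intro!: sum_nonneg)
qed

lemma e_positive_X_e_lollipop:
  assumes "1 \<le> a" "a \<le> b" "b \<le> N"
  shows "e_positive (X_e (lollipop a (N - a)) (lollipop b (N - b)))"
  using assms lollipop_terms_expansion[of a b N]
  by (simp add: e_positive_def X_e_lollipop_le e_coeff_ops)

text \<open>The sum of terms from a to b has nonnegative coefficients, and by assumption so has a
  negative multiple of it; hence it is 0.\<close>

lemma lollipop_antisym:
  assumes "1 \<le> a" "a \<le> b" "b \<le> N"
    and pos: "e_positive (X_e (lollipop b (N - b)) (lollipop a (N - a)))"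
  shows "chrom_sym (lollipop a (N - a)) = chrom_sym (lollipop b (N - b))"
proof -
  let ?T = "\<Sum>j\<in>{a..<b}. lollipop_term N j"
  have T: "e_expandable ?T" "e_coeff p ?T \<ge> 0" for p
    using assms by (auto intro: lollipop_terms_expansion)
  have "e_coeff p ?T = 0" if "partition p" for p
  proof -
    have "- fact (b - 1) * e_coeff p ?T \<ge> 0"
      using pos that e_coeff_ops(3)[OF T(1)]
      unfolding e_positive_def X_e_lollipop_le(2)[OF assms(1-3)] by metis
    moreover have "fact (b - 1) * e_coeff p ?T > 0" if "e_coeff p ?T > 0"
      using that by (intro mult_pos_pos) simp_all
    ultimately show ?thesis using T(2)[of p] by fastforce
  qed
  then have "?T = 0" using T(1) eq_zero_if_e_coeff_zero by blast
  moreover define c :: rat where "c = fact (a - 1) / fact (b - 1)"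
  moreover have "X_e (lollipop a (N - a)) (lollipop b (N - b)) = lollipop_series a (N - a)
      - smult c (lollipop_series b (N - b))"
    using assms by (simp add: X_e_def chrom_sym_lollipop lollipop_series_expansion c_def)
  ultimately have eq: "lollipop_series a (N - a) = smult c (lollipop_series b (N - b))"
    using assms by (simp add: X_e_lollipop_le) (metis eq_iff_diff_eq_0 mseries_eqI mcoeff_simps(1,5) mult_zero_right)
  \<comment> \<open>The squarefree coefficient is the same nonzero number for all lollipops on N
    vertices, which pins the proportionality factor to 1.\<close>
  have "mcoeff (lollipop_series k (N - k)) (mset_set {1..N}) = fact N" if "k \<le> N" for k
    using mcoeff_lollipop_series_squarefree[of k "N - k"] that by simp
  then have "c = 1"
    using arg_cong[OF eq, of "\<lambda>F. mcoeff F (mset_set {1..N})"] assms by simp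
  then show ?thesis using eq assms by (simp add: chrom_sym_lollipop)
qed

section \<open>The chain of lollipop classes\<close>

abbreviation lollipop_class :: "nat \<Rightarrow> nat \<Rightarrow> graph set" where
  "lollipop_class N a \<equiv> E_class N (lollipop a (N - a))"

lemma E_class_eqI:
  assumes "G \<in> connected_graphs N" "H \<in> connected_graphs N" "chrom_sym G = chrom_sym H"
  shows "E_class N G = E_class N H"
  using assms by (auto simp: E_class_def chrom_rel_def)

lemma X_e_cong:
  assumes "(G, G') \<in> chrom_rel N" "(H, H') \<in> chrom_rel N"
  shows "X_e G H = X_e G' H'"
  using assms by (simp add: X_e_def chrom_rel_def connected_graphs_def)

text \<open>The order asks for some representatives; \<open>X_e_cong\<close> allows replacing them
  by the given graphs.\<close>

lemma E_le_iff:
  assumes "G \<in> connected_graphs N" "H \<in> connected_graphs N"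
  shows "(E_class N H, E_class N G) \<in> E_le N \<longleftrightarrow> e_positive (X_e G H)"
proof -
  have "E_class N G \<in> E_set N" "E_class N H \<in> E_set N"
    using assms by (auto simp: E_class_def E_set_def intro: quotientI)
  moreover have "(G, G) \<in> chrom_rel N" "(H, H) \<in> chrom_rel N"
    using assms by (auto simp: chrom_rel_def)
  ultimately show ?thesis
    unfolding E_le_def by (auto simp: E_class_def dest: X_e_cong)
qed

lemma lollipop_in_connected_graphs:
  "1 \<le> a \<Longrightarrow> a \<le> N \<Longrightarrow> lollipop a (N - a) \<in> connected_graphs N"
  using lollipop_connected[of a "N - a"] by simp

lemma lollipop_class_le:
  assumes "1 \<le> a" "a \<le> b" "b \<le> N"
  shows "(lollipop_class N b, lollipop_class N a) \<in> E_le N"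
  using assms by (simp add: E_le_iff lollipop_in_connected_graphs e_positive_X_e_lollipop)

text \<open>Classes are compared rather than sizes, since different a and b may give the same
  class.\<close>

lemma lollipop_class_antisym:
  assumes "1 \<le> a" "a \<le> b" "b \<le> N" "(lollipop_class N a, lollipop_class N b) \<in> E_le N"
  shows "lollipop_class N a = lollipop_class N b"
  using assms by (intro E_class_eqI lollipop_antisym)
    (simp_all add: E_le_iff lollipop_in_connected_graphs)

lemma lollipop_classes_eq: "lollipop_classes N = lollipop_class N ` {1..N}"
proof (intro equalityI subsetI)
  fix A assume "A \<in> lollipop_classes N"
  then obtain m n where "A = E_class N (lollipop m n)" "m \<ge> 1" "m + n = N"
    by (auto simp: lollipop_classes_def)
  then show "A \<in> lollipop_class N ` {1..N}" by (intro image_eqI[of _ _ m]) auto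
next
  fix A assume "A \<in> lollipop_class N ` {1..N}"
  then obtain m where "A = lollipop_class N m" "m \<ge> 1" "m + (N - m) = N" by auto
  then show "A \<in> lollipop_classes N" unfolding lollipop_classes_def by blast
qed

theorem theorem3p17:
  shows "(\<forall>N\<ge>1. lollipop_classes N \<in> Chains (E_le N)) \<and>
    (\<forall>m n. m \<ge> 3 \<longrightarrow>
      (E_class (m + n) (lollipop m n), E_class (m + n) (lollipop (m - 1) (n + 1))) \<in> E_le (m + n)) \<and>
    (\<forall>N\<ge>1. maximal_in (E_le N) (lollipop_classes N) (E_class N (path_graph N)) \<and>
      minimal_in (E_le N) (lollipop_classes N) (E_class N (complete_graph N)))"
proof (intro conjI allI impI)
  fix N :: nat
  show "lollipop_classes N \<in> Chains (E_le N)"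
  proof -
    have "(lollipop_class N a, lollipop_class N b) \<in> E_le N \<or>
        (lollipop_class N b, lollipop_class N a) \<in> E_le N" if "a \<in> {1..N}" "b \<in> {1..N}" for a b
      using that lollipop_class_le[of a b N] lollipop_class_le[of b a N] by (cases "a \<le> b") auto
    then show ?thesis unfolding Chains_def lollipop_classes_eq by blast
  qed
next
  fix m n :: nat
  assume "m \<ge> 3"
  \<comment> \<open>Neighboring sizes a = m - 1 and b = m; the tail for a has length n + 1.\<close>
  then show "(E_class (m + n) (lollipop m n), E_class (m + n) (lollipop (m - 1) (n + 1))) \<in> E_le (m + n)"
    using lollipop_class_le[of "m - 1" m "m + n"] by (simp add: Suc_diff_le)
next
  fix N :: nat
  assume N: "N \<ge> 1"
  \<comment> \<open>The smallest complete part is the top and the largest the bottom. The form N - N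
    fits the abbreviation \<open>lollipop_class\<close>.\<close>
  have path: "path_graph N = lollipop 1 (N - 1)"
    and complete: "complete_graph N = lollipop N (N - N)"
    using N by (simp_all add: path_graph_eq_lollipop complete_graph_eq_lollipop)
  have mem: "lollipop_class N a \<in> lollipop_classes N" if "1 \<le> a" "a \<le> N" for a
    using that by (simp add: lollipop_classes_eq)
  show "maximal_in (E_le N) (lollipop_classes N) (E_class N (path_graph N))"
    unfolding maximal_in_def path
  proof (intro conjI ballI impI)
    fix A assume "A \<in> lollipop_classes N" and le: "(lollipop_class N 1, A) \<in> E_le N"
    then obtain a where "A = lollipop_class N a" "1 \<le> a" "a \<le> N"
      by (auto simp: lollipop_classes_eq)
    then show "A = lollipop_class N 1"
      using le lollipop_class_antisym[of 1 a N] by simp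
  qed (intro mem N order_refl)
  show "minimal_in (E_le N) (lollipop_classes N) (E_class N (complete_graph N))"
    unfolding minimal_in_def complete
  proof (intro conjI ballI impI)
    fix A assume "A \<in> lollipop_classes N" and le: "(A, lollipop_class N N) \<in> E_le N"
    then obtain a where "A = lollipop_class N a" "1 \<le> a" "a \<le> N"
      by (auto simp: lollipop_classes_eq)
    then show "A = lollipop_class N N"
      using le lollipop_class_antisym[of a N N] by simp
  qed (intro mem N order_refl)
qed

end
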